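(* The function $J$ satisfies, for all $x\in\mathbb{N}_0$ and $y\ge0$, $$J(x,y)=\beta^\gamma\max_{a\in A(x)}\Big[\sum_{x'\in X}J\Big(x',\frac{a+y}{\beta}\Big)q(x'|x,a)\Big]=\beta^\gamma\max_{a\in A(x)}\Big[\sum_{k=-\infty}^{\infty}J\Big(x-a+k,\frac{a+y}{\beta}\Big)q_k\Big].$$
   Context: Setting. $X=\mathbb{Z}$, $\beta\in(0,1)$ is a discount factor, $Z_1,Z_2,\ldots$ are i.i.d. integer-valued random variables with $\mathbb{P}(Z_n=k)=q_k$, $k\in\mathbb{Z}$; $Z$ denotes a generic copy. Standing assumptions: $\mathbb{E}Z^+<\infty$ (where $Z^+=\max\{Z,0\}$) and $\mathbb{P}(Z<0)>0$. Action sets: $A(x)=\{0,\ldots,x\}$ for $x\ge0$ and $A(x)=\{0\}$ for $x<0$; $D=\{(x,a):x\in X,a\in A(x)\}$. A policy $\pi=(\pi_k)_{k\ge0}$ is a sequence of maps assigning to each history $(x_0,a_0,\ldots,x_{k-1},a_{k-1},x_k)$ with $(x_m,a_m)\in D$ an action in $A(x_k)$; $\Pi$ is the set of all policies. Under $\pi$ and $x_0=x$, $a_k=\pi_k(x_0,a_0,\ldots,x_k)$, and $x_{k+1}=x_k-a_k+Z_{k+1}$ if $x_k\ge0$, $x_{k+1}=x_k$ if $x_k<0$; expectation is $\mathbb{E}_x^\pi$. Transition probabilities: $q(y|x,a)=q_{y-x+a}$ for $x\ge0$ and $q(x|x,a)=1$ for $x<0$. The ruin time $\tau$ is the smallest $n\in\mathbb{N}_0$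 with $x_n<0$ ($\tau=\infty$ if there is none). Fix $\gamma\in(0,1)$. For $x\in X$, $y\ge0$, $$J_\pi(x,y)=\mathbb{E}_x^\pi\Big(\sum_{k=0}^{\tau-1}\beta^k a_k+y\Big)^\gamma,\qquad J(x,y)=\sup_{\pi\in\Pi}J_\pi(x,y),$$ empty sums being $0$; thus $J(x,y)=y^\gamma$ for $x<0$. *)

theory Defs
  imports "HOL-Probability.Probability"
begin

type_synonym history = "(int \<times> int) list \<times> int"

text \<open>The history \<open>(x\<^sub>0, a\<^sub>0, \<dots>, x\<^sub>k\<^sub>-\<^sub>1, a\<^sub>k\<^sub>-\<^sub>1, x\<^sub>k)\<close> is encoded as
  \<open>([(x\<^sub>0, a\<^sub>0), \<dots>, (x\<^sub>k\<^sub>-\<^sub>1, a\<^sub>k\<^sub>-\<^sub>1)], x\<^sub>k)\<close>.\<close>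

definition actions :: "int \<Rightarrow> int set" where
  "actions x = (if x \<ge> 0 then {0..x} else {0})"

definition admissible_pairs :: "(int \<times> int) set" where
  "admissible_pairs = {(x, a). a \<in> actions x}"

definition histories :: "nat \<Rightarrow> history set" where
  "histories k = {(h, x). length h = k \<and> set h \<subseteq> admissible_pairs}"

text \<open>Only the restriction of \<open>\<pi> k\<close> to \<open>histories k\<close> matters: the controlled process below
  never evaluates a policy anywhere else.\<close>

definition policies :: "(nat \<Rightarrow> history \<Rightarrow> int) set" where
  "policies = {\<pi>. \<forall>k. \<forall>(h, x) \<in> histories k. \<pi> k (h, x) \<in> actions x}"

text \<open>In the following, \<open>z n\<close> is the realised value of the increment \<open>Z\<^sub>n\<close> for \<open>n \<ge> 1\<close>;
  \<open>z 0\<close> is never used.\<close>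

primrec history_at :: "(nat \<Rightarrow> history \<Rightarrow> int) \<Rightarrow> int \<Rightarrow> (nat \<Rightarrow> int) \<Rightarrow> nat \<Rightarrow> history" where
  "history_at \<pi> x z 0 = ([], x)"
| "history_at \<pi> x z (Suc k) =
    (let (h, s) = history_at \<pi> x z k; a = \<pi> k (h, s)
     in (h @ [(s, a)], if s \<ge> 0 then s - a + z (Suc k) else s))"

definition state_at :: "(nat \<Rightarrow> history \<Rightarrow> int) \<Rightarrow> int \<Rightarrow> (nat \<Rightarrow> int) \<Rightarrow> nat \<Rightarrow> int" where
  "state_at \<pi> x z k = snd (history_at \<pi> x z k)"

definition action_at :: "(nat \<Rightarrow> history \<Rightarrow> int) \<Rightarrow> int \<Rightarrow> (nat \<Rightarrow> int) \<Rightarrow> nat \<Rightarrow> int" where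
  "action_at \<pi> x z k = \<pi> k (history_at \<pi> x z k)"

definition ruin_time :: "(nat \<Rightarrow> history \<Rightarrow> int) \<Rightarrow> int \<Rightarrow> (nat \<Rightarrow> int) \<Rightarrow> enat" where
  "ruin_time \<pi> x z =
    (if \<exists>n. state_at \<pi> x z n < 0 then enat (LEAST n. state_at \<pi> x z n < 0) else \<infinity>)"

text \<open>The sum up to \<open>\<tau> - 1\<close> is a series of non-negative terms when \<open>\<tau> = \<infinity>\<close>, hence the
  values in \<^typ>\<open>ennreal\<close>.\<close>

definition discounted_dividends ::
  "real \<Rightarrow> (nat \<Rightarrow> history \<Rightarrow> int) \<Rightarrow> int \<Rightarrow> (nat \<Rightarrow> int) \<Rightarrow> ennreal" where
  "discounted_dividends \<beta> \<pi> x z =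
    (\<Sum>k. if enat k < ruin_time \<pi> x z
          then ennreal (\<beta> ^ k * of_int (action_at \<pi> x z k)) else 0)"

definition ennreal_powr :: "ennreal \<Rightarrow> real \<Rightarrow> ennreal" where
  "ennreal_powr r \<gamma> = (if r = \<top> then \<top> else ennreal (enn2real r powr \<gamma>))"

definition policy_value ::
  "'w measure \<Rightarrow> (nat \<Rightarrow> 'w \<Rightarrow> int) \<Rightarrow> real \<Rightarrow> real \<Rightarrow> (nat \<Rightarrow> history \<Rightarrow> int)
    \<Rightarrow> int \<Rightarrow> real \<Rightarrow> ennreal" where
  "policy_value M Z \<beta> \<gamma> \<pi> x y =
    (\<integral>\<^sup>+ \<omega>. ennreal_powr (discounted_dividends \<beta> \<pi> x (\<lambda>n. Z n \<omega>) + ennreal y) \<gamma> \<partial>M)"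

definition value_fun ::
  "'w measure \<Rightarrow> (nat \<Rightarrow> 'w \<Rightarrow> int) \<Rightarrow> real \<Rightarrow> real \<Rightarrow> int \<Rightarrow> real \<Rightarrow> ennreal" where
  "value_fun M Z \<beta> \<gamma> x y = (SUP \<pi>\<in>policies. policy_value M Z \<beta> \<gamma> \<pi> x y)"

text \<open>\<open>transition q x' x a\<close> is \<open>q(x' | x, a)\<close>.\<close>

definition transition :: "(int \<Rightarrow> real) \<Rightarrow> int \<Rightarrow> int \<Rightarrow> int \<Rightarrow> real" where
  "transition q x' x a = (if x \<ge> 0 then q (x' - x + a) else if x' = x then 1 else 0)"

end

theory Submission
  imports Defs
begin

text \<open>
  The equation expresses that dynamic programming works once the dividends already collected are
  carried along as a second state variable. If the first action is \<open>a\<close>, then the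
  discounted dividends are \<open>a + \<beta> D'\<close>, where \<open>D'\<close> belongs to the policy that continues after the
  first step, and therefore
  \<open>(a + \<beta> D' + y)\<^sup>\<gamma> = \<beta>\<^sup>\<gamma> (D' + (a + y) / \<beta>)\<^sup>\<gamma>\<close>. Since the increments are independent and identically
  distributed, the increments from the second on are again such a sequence and independent of the
  first one. Taking expectations thus gives
  \<open>J\<^sub>\<pi>(x, y) = \<beta>\<^sup>\<gamma> \<Sum>\<^sub>k q\<^sub>k J\<^sub>\<pi>\<^sub>'(x - a + k, (a + y) / \<beta>)\<close> with a continuation policy \<open>\<pi>'\<close> that does
  not depend on \<open>k\<close> (\<open>policy_value_first_step\<close>).

  Bounding \<open>J\<^sub>\<pi>\<^sub>'\<close> by \<open>J\<close> gives one inequality. For the other one, let \<open>a\<close> attain the maximum. The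
  continuation policy may depend on the whole history, in particular on the state reached after the
  first step; hence a separate continuation \<open>\<sigma>\<^sub>k\<close> may be prescribed for every \<open>k\<close> (\<open>paste\<close>).
  So the supremum may be moved inside the sum over \<open>k\<close> (\<open>nn_integral_SUP_le_choice\<close>): choose for
  each \<open>k\<close> a sequence of policies whose values increase to the supremum and apply monotone
  convergence. All quantities take values in \<open>[0, \<infinity>]\<close>, so that this argument covers infinite
  values as well.
\<close>

section \<open>Countable sums in the extended nonnegative reals\<close>

lemma infsum_eq_nn_integral_count_space:
  fixes f :: "int \<Rightarrow> ennreal"
  shows "(\<Sum>\<^sub>\<infinity>k\<in>UNIV. f k) = (\<integral>\<^sup>+k. f k \<partial>count_space UNIV)"
proof -
  have bij: "bij_betw (from_nat_into (UNIV :: int set)) UNIV UNIV"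
    by (intro bij_betw_from_nat_into) (auto simp: infinite_UNIV_int)
  let ?g = "\<lambda>n. f (from_nat_into UNIV n)"
  have "?g sums infsum ?g UNIV"
    by (intro has_sum_imp_sums has_sum_infsum nonneg_summable_on_complete) simp
  then have "(\<Sum>n. ?g n) = infsum ?g UNIV"
    by (simp add: sums_iff)
  then show ?thesis
    using infsum_reindex_bij_betw[OF bij, of f] nn_integral_bij_count_space[OF bij, of f]
    by (simp add: nn_integral_count_space_nat)
qed

text \<open>
  For each \<open>k\<close> there is a sequence of parameters whose values increase to the supremum; monotone
  convergence then bounds the sum of the suprema. A sequence is used instead of one almost optimal
  parameter for each \<open>k\<close>, because suprema may be infinite.
\<close>

lemma nn_integral_SUP_le_choice:
  fixes f :: "'k \<Rightarrow> 'p \<Rightarrow> ennreal"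
  assumes "P \<noteq> {}"
    and bound: "\<And>\<sigma>. (\<And>k. \<sigma> k \<in> P) \<Longrightarrow> (\<integral>\<^sup>+k. f k (\<sigma> k) \<partial>count_space UNIV) \<le> c"
  shows "(\<integral>\<^sup>+k. (SUP p\<in>P. f k p) \<partial>count_space UNIV) \<le> c"
proof -
  have "\<exists>s. (\<forall>i::nat. s i \<in> P) \<and> incseq (\<lambda>i. f k (s i)) \<and> (SUP p\<in>P. f k p) = (SUP i. f k (s i))" for k
  proof -
    obtain g :: "nat \<Rightarrow> ennreal" where g: "incseq g" "range g \<subseteq> f k ` P" "(SUP p\<in>P. f k p) = (SUP i. g i)"
      using ennreal_Sup_countable_SUP[of "f k ` P"] assms(1) by auto
    then have "\<forall>i. \<exists>p\<in>P. g i = f k p" by blast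
    then obtain s where "\<forall>i. s i \<in> P \<and> g i = f k (s i)" by metis
    moreover from this have "g = (\<lambda>i. f k (s i))" by auto
    ultimately show ?thesis using g by auto
  qed
  then obtain s where s: "\<And>k i. s k (i::nat) \<in> P" "\<And>k. incseq (\<lambda>i. f k (s k i))"
      "\<And>k. (SUP p\<in>P. f k p) = (SUP i. f k (s k i))"
    by metis
  have "(\<integral>\<^sup>+k. (SUP p\<in>P. f k p) \<partial>count_space UNIV)
      = (SUP i. \<integral>\<^sup>+k. f k (s k i) \<partial>count_space UNIV)"
    unfolding s(3)
    by (rule nn_integral_monotone_convergence_SUP)
       (use s(2) in \<open>auto simp: incseq_def le_fun_def\<close>)
  also have "\<dots> \<le> c"
    by (intro SUP_least bound s(1))
  finally show ?thesis .
qed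

section \<open>Rewards\<close>

lemma ennreal_powr_mult:
  assumes "b > 0"
  shows "ennreal_powr (ennreal b * r) \<gamma> = ennreal (b powr \<gamma>) * ennreal_powr r \<gamma>"
proof (cases r)
  case (real t)
  then show ?thesis
    using assms by (simp add: ennreal_powr_def powr_mult flip: ennreal_mult)
next
  case top
  then show ?thesis
    using assms by (simp add: ennreal_powr_def ennreal_mult_top)
qed

lemma measurable_ennreal_powr [measurable]:
  "(\<lambda>r. ennreal_powr r \<gamma>) \<in> borel_measurable borel"
  unfolding ennreal_powr_def by measurable

lemma zero_in_actions: "0 \<in> actions x"
  by (simp add: actions_def)

section \<open>Histories and ruin\<close>

lemma policy_in_actions:
  assumes "\<pi> \<in> policies" "H \<in> histories k"
  shows "\<pi> k H \<in> actions (snd H)"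
  using assms by (cases H) (fastforce simp: policies_def)

text \<open>
  The process starts to use increments with the one of index 1, so the sequences may differ
  at index 0. This freedom is used below to prepend an irrelevant value 0 to a
  sequence of increments that is indexed from 0.
\<close>

lemma history_at_cong:
  assumes "\<And>n. z (Suc n) = z' (Suc n)"
  shows "history_at \<pi> x z k = history_at \<pi> x z' k"
  by (induction k) (simp_all only: history_at.simps assms)

lemma history_at_in_histories:
  assumes "\<pi> \<in> policies"
  shows "history_at \<pi> x z k \<in> histories k"
proof (induction k)
  case 0
  then show ?case by (simp add: histories_def)
next
  case (Suc k)
  then show ?case
    using assms
    by (auto simp: histories_def policies_def admissible_pairs_def Let_def split: prod.splits)
qed

lemma action_at_nonneg:
  assumes "\<pi> \<in> policies"
  shows "action_at \<pi> x z k \<ge> 0"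
proof -
  have "action_at \<pi> x z k \<in> actions (snd (history_at \<pi> x z k))"
    unfolding action_at_def by (intro policy_in_actions history_at_in_histories assms)
  then show ?thesis by (auto simp: actions_def split: if_splits)
qed

text \<open>
  Unlike the ruin time itself, this condition involves finitely many states only, which makes it
  easy to shift in time and evidently measurable.
\<close>

lemma before_ruin_iff: "enat k < ruin_time \<pi> x z \<longleftrightarrow> (\<forall>j\<le>k. state_at \<pi> x z j \<ge> 0)"
proof (cases "\<exists>n. state_at \<pi> x z n < 0")
  case True
  let ?m = "LEAST n. state_at \<pi> x z n < 0"
  have "state_at \<pi> x z ?m < 0" using True by (rule LeastI_ex)
  moreover have "state_at \<pi> x z j \<ge> 0" if "j < ?m" for j
    using not_less_Least[OF that] by simp
  ultimately have "k < ?m \<longleftrightarrow> (\<forall>j\<le>k. state_at \<pi> x z j \<ge> 0)"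
    by (metis not_less le_less_trans)
  then show ?thesis using True by (simp add: ruin_time_def)
next
  case False
  then have "ruin_time \<pi> x z = \<infinity>" by (simp add: ruin_time_def)
  with False show ?thesis by (auto simp: not_less)
qed

section \<open>The first step of a policy\<close>

text \<open>
  The policy that \<open>\<pi>\<close> induces from time 1 on, after action \<open>a\<close> in state \<open>x\<close>. It sees only the
  history from time 1 on, so \<open>(x, a)\<close> is put back in front before \<open>\<pi>\<close> is consulted.
\<close>

definition continuation :: "(nat \<Rightarrow> history \<Rightarrow> int) \<Rightarrow> int \<Rightarrow> int \<Rightarrow> nat \<Rightarrow> history \<Rightarrow> int" where
  "continuation \<pi> x a k = (\<lambda>(h, s). \<pi> (Suc k) ((x, a) # h, s))"

lemma continuation_in_policies:
  assumes "\<pi> \<in> policies" "a \<in> actions x"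
  shows "continuation \<pi> x a \<in> policies"
proof -
  have "((x, a) # h, s) \<in> histories (Suc k)" if "(h, s) \<in> histories k" for k h s
    using that assms(2) by (auto simp: histories_def admissible_pairs_def)
  then show ?thesis
    using assms(1) by (fastforce simp: policies_def continuation_def)
qed

lemma history_at_Suc_continuation:
  assumes "x \<ge> 0" and a: "a = \<pi> 0 ([], x)"
  shows "history_at \<pi> x z (Suc k) =
    (let (h, s) = history_at (continuation \<pi> x a) (x - a + z 1) (\<lambda>n. z (Suc n)) k in ((x, a) # h, s))"
proof (induction k)
  case 0
  then show ?case using assms by (simp add: Let_def)
next
  case (Suc k)
  obtain h s where "history_at (continuation \<pi> x a) (x - a + z 1) (\<lambda>n. z (Suc n)) k = (h, s)"
    by fastforce
  then show ?case
    using Suc unfolding history_at.simps(2)[of \<pi> x z "Suc k"]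
    by (simp add: continuation_def[of \<pi> x a k] Let_def)
qed

lemma state_at_Suc_continuation:
  assumes "x \<ge> 0" "a = \<pi> 0 ([], x)"
  shows "state_at \<pi> x z (Suc k) =
    state_at (continuation \<pi> x a) (x - a + z 1) (\<lambda>n. z (Suc n)) k"
  unfolding state_at_def history_at_Suc_continuation[of x a \<pi>, OF assms]
  by (simp add: Let_def split: prod.splits)

lemma action_at_Suc_continuation:
  assumes "x \<ge> 0" "a = \<pi> 0 ([], x)"
  shows "action_at \<pi> x z (Suc k) =
    action_at (continuation \<pi> x a) (x - a + z 1) (\<lambda>n. z (Suc n)) k"
  unfolding action_at_def history_at_Suc_continuation[of x a \<pi>, OF assms]
  by (simp add: continuation_def Let_def split: prod.splits)

text \<open>
  For \<open>x \<ge> 0\<close> time 0 lies before ruin, so \<open>a\<close> counts, and the process from time 1 on is ruined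
  exactly one step before the original one. Shifting the summation index produces the factor \<open>\<beta>\<close>.
\<close>

lemma discounted_dividends_first_step:
  assumes "\<pi> \<in> policies" "x \<ge> 0" "\<beta> > 0" and a: "a = \<pi> 0 ([], x)"
  shows "discounted_dividends \<beta> \<pi> x z = ennreal (of_int a) +
    ennreal \<beta> * discounted_dividends \<beta> (continuation \<pi> x a) (x - a + z 1) (\<lambda>n. z (Suc n))"
proof -
  define t where "t k = (if enat k < ruin_time \<pi> x z
      then ennreal (\<beta> ^ k * of_int (action_at \<pi> x z k)) else 0)" for k
  let ?\<pi> = "continuation \<pi> x a" and ?x = "x - a + z 1" and ?z = "\<lambda>n. z (Suc n)"
  define t' where "t' k = (if enat k < ruin_time ?\<pi> ?x ?z
      then ennreal (\<beta> ^ k * of_int (action_at ?\<pi> ?x ?z k)) else 0)" for k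
  have s0: "state_at \<pi> x z 0 \<ge> 0" using assms by (simp add: state_at_def)
  have t0: "t 0 = ennreal (of_int a)"
    using s0 by (simp add: t_def before_ruin_iff a action_at_def)
  have "enat (Suc k) < ruin_time \<pi> x z \<longleftrightarrow> enat k < ruin_time ?\<pi> ?x ?z" for k
    unfolding before_ruin_iff state_at_Suc_continuation[of x a \<pi>, OF assms(2) a, symmetric]
    using s0 by (metis Suc_le_mono not0_implies_Suc)
  then have tS: "t (Suc k) = ennreal \<beta> * t' k" for k
    using \<open>\<beta> > 0\<close>
    by (simp add: t_def t'_def action_at_Suc_continuation[of x a \<pi>, OF assms(2) a] ennreal_mult' mult.assoc)
  \<comment> \<open>Values may be infinite, so the first term is added to the rest of the series and
    not subtracted from the whole.\<close>
  have "(\<lambda>k. t (Suc k)) sums (\<Sum>k. t (Suc k))" by (intro summable_sums) simp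
  then have "t sums ((\<Sum>k. t (Suc k)) + t 0)" by (rule sums_Suc)
  then have "(\<Sum>k. t k) = t 0 + (\<Sum>k. t (Suc k))" by (simp add: sums_iff add.commute)
  then show ?thesis
    unfolding discounted_dividends_def t_def[symmetric] t'_def[symmetric] t0 tS
    by simp
qed

section \<open>Pasting policies\<close>

definition first_state :: "history \<Rightarrow> int" where
  "first_state = (\<lambda>(h, s). case h of [] \<Rightarrow> s | p # _ \<Rightarrow> fst p)"

text \<open>
  After the first step a different policy is followed for every state reached by it. That
  state must be recovered from the history at each later time. In states other than \<open>x\<close> the initial
  action is 0, because it is always allowed.
\<close>

definition paste :: "int \<Rightarrow> int \<Rightarrow> (int \<Rightarrow> nat \<Rightarrow> history \<Rightarrow> int) \<Rightarrow> nat \<Rightarrow> history \<Rightarrow> int" where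
  "paste x a \<sigma> k = (\<lambda>(h, s). case k of
     0 \<Rightarrow> if s = x then a else 0
   | Suc n \<Rightarrow> \<sigma> (first_state (tl h, s)) n (tl h, s))"

lemma paste_in_policies:
  assumes "a \<in> actions x" "\<And>s. \<sigma> s \<in> policies"
  shows "paste x a \<sigma> \<in> policies"
proof -
  have "paste x a \<sigma> k (h, s) \<in> actions s" if hs: "(h, s) \<in> histories k" for k h s
  proof (cases k)
    case 0
    then show ?thesis using assms(1) zero_in_actions by (simp add: paste_def)
  next
    case (Suc n)
    then have "(tl h, s) \<in> histories n"
      using hs by (cases h) (auto simp: histories_def)
    then have "\<sigma> (first_state (tl h, s)) n (tl h, s) \<in> actions s"
      using assms(2)[of "first_state (tl h, s)"] by (auto simp: policies_def)
    then show ?thesis using Suc by (simp add: paste_def)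
  qed
  then show ?thesis by (auto simp: policies_def)
qed

lemma continuation_paste:
  "continuation (paste x a \<sigma>) x a n H = \<sigma> (first_state H) n H"
  by (simp add: continuation_def paste_def split: prod.splits)

lemma first_state_history_at: "first_state (history_at \<pi> x z k) = x"
proof (induction k)
  case 0
  then show ?case by (simp add: first_state_def)
next
  case (Suc k)
  then show ?case
    by (auto simp: first_state_def Let_def split: prod.splits list.splits)
qed

text \<open>
  All histories that start in \<open>s\<close> have first state \<open>s\<close>, so that along them the pasted policy
  never switches away from \<open>\<sigma> s\<close>.
\<close>

lemma history_at_continuation_paste:
  "history_at (continuation (paste x a \<sigma>) x a) s z k = history_at (\<sigma> s) s z k"
proof (induction k)
  case 0
  then show ?case by simp
next
  case (Suc k)
  have "continuation (paste x a \<sigma>) x a k (history_at (\<sigma> s) s z k) = \<sigma> s k (history_at (\<sigma> s) s z k)"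
    by (simp add: continuation_paste first_state_history_at)
  then show ?case
    using Suc by (auto simp: Let_def split: prod.splits)
qed

lemma discounted_dividends_cong:
  assumes "\<And>k. history_at \<pi> x z k = history_at \<pi>' x' z' k"
    and "\<And>k. \<pi> k (history_at \<pi> x z k) = \<pi>' k (history_at \<pi>' x' z' k)"
  shows "discounted_dividends \<beta> \<pi> x z = discounted_dividends \<beta> \<pi>' x' z'"
proof -
  have "state_at \<pi> x z k = state_at \<pi>' x' z' k" "action_at \<pi> x z k = action_at \<pi>' x' z' k" for k
    using assms by (simp_all add: state_at_def action_at_def)
  then show ?thesis
    by (simp add: discounted_dividends_def before_ruin_iff cong: if_cong)
qed

lemma discounted_dividends_cong_increments:
  assumes "\<And>n. z (Suc n) = z' (Suc n)"
  shows "discounted_dividends \<beta> \<pi> x z = discounted_dividends \<beta> \<pi> x z'"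
  by (intro discounted_dividends_cong) (simp_all add: history_at_cong[of z z', OF assms])

lemma discounted_dividends_continuation_paste:
  "discounted_dividends \<beta> (continuation (paste x a \<sigma>) x a) s z = discounted_dividends \<beta> (\<sigma> s) s z"
  by (intro discounted_dividends_cong)
     (simp_all add: history_at_continuation_paste continuation_paste first_state_history_at)

lemma policy_value_continuation_paste:
  "policy_value M Z \<beta> \<gamma> (continuation (paste x a \<sigma>) x a) s y = policy_value M Z \<beta> \<gamma> (\<sigma> s) s y"
  by (simp add: policy_value_def discounted_dividends_continuation_paste)

section \<open>Measurability\<close>

abbreviation sequence_algebra :: "(nat \<Rightarrow> int) measure" where
  "sequence_algebra \<equiv> PiM UNIV (\<lambda>_. count_space UNIV)"

text \<open>
  Policies are arbitrary functions, but they act on the countable set of histories, on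
  which every function is measurable.
\<close>

lemma measurable_history_at:
  "(\<lambda>w. history_at \<pi> x (case_nat c w) k) \<in> sequence_algebra \<rightarrow>\<^sub>M count_space UNIV"
proof (induction k)
  case 0
  then show ?case by simp
next
  case (Suc k)
  have "(\<lambda>w. (let (h, s) = H; a = \<pi> k (h, s)
     in (h @ [(s, a)], if s \<ge> 0 then s - a + w k else s))) \<in> sequence_algebra \<rightarrow>\<^sub>M count_space UNIV"
    for H :: history
  proof -
    have "(\<lambda>w. w k) \<in> sequence_algebra \<rightarrow>\<^sub>M count_space UNIV"
      by (rule measurable_component_singleton) simp
    then show ?thesis
      by (rule measurable_compose[where g="\<lambda>v. (let (h, s) = H; a = \<pi> k (h, s)
            in (h @ [(s, a)], if s \<ge> 0 then s - a + v else s))"]) simp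
  qed
  from measurable_compose_countable[where f = "\<lambda>H w. (let (h, s) = H; a = \<pi> k (h, s)
     in (h @ [(s, a)], if s \<ge> 0 then s - a + w k else s))", OF this Suc]
  show ?case by (simp only: history_at.simps nat.case)
qed

lemma measurable_discounted_dividends:
  "(\<lambda>w. discounted_dividends \<beta> \<pi> x (case_nat c w)) \<in> borel_measurable sequence_algebra"
proof -
  have [measurable]: "(\<lambda>w. state_at \<pi> x (case_nat c w) k) \<in> sequence_algebra \<rightarrow>\<^sub>M count_space UNIV"
    "(\<lambda>w. action_at \<pi> x (case_nat c w) k) \<in> sequence_algebra \<rightarrow>\<^sub>M count_space UNIV" for k
    unfolding state_at_def action_at_def
    by (rule measurable_compose[OF measurable_history_at], simp)+
  show ?thesis
    unfolding discounted_dividends_def before_ruin_iff by measurable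
qed

section \<open>Independent and identically distributed increments\<close>

lemma (in prob_space) indep_sets_reindex:
  assumes inj: "inj_on f I" and indep: "indep_sets F (f ` I)"
  shows "indep_sets (\<lambda>i. F (f i)) I"
proof (rule indep_setsI)
  show "F (f i) \<subseteq> events" if "i \<in> I" for i
    using indep that by (auto simp: indep_sets_def)
next
  fix A J assume J: "J \<noteq> {}" "J \<subseteq> I" "finite J" and A: "\<forall>j\<in>J. A j \<in> F (f j)"
  define g where "g = inv_into J f"
  have inj': "inj_on f J" using inj J(2) by (rule inj_on_subset)
  then have g: "g (f j) = j" if "j \<in> J" for j
    using that by (simp add: g_def)
  have "prob (\<Inter>i\<in>f ` J. A (g i)) = (\<Prod>i\<in>f ` J. prob (A (g i)))"
    using J A by (intro indep_setsD[OF indep]) (auto simp: g)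
  then show "prob (\<Inter>j\<in>J. A j) = (\<Prod>j\<in>J. prob (A j))"
    by (simp add: g prod.reindex[OF inj'] cong: prod.cong INF_cong_simp)
qed

lemma (in prob_space) indep_vars_reindex:
  assumes "inj_on f I" "indep_vars M' X (f ` I)"
  shows "indep_vars (\<lambda>i. M' (f i)) (\<lambda>i. X (f i)) I"
  using assms indep_sets_reindex unfolding indep_vars_def2 by fastforce

locale iid_increments = prob_space M for M :: "'w measure" +
  fixes Z :: "nat \<Rightarrow> 'w \<Rightarrow> int" and q :: "int \<Rightarrow> real"
  assumes indep: "indep_vars (\<lambda>_. count_space UNIV) Z {1..}"
    and law: "\<And>n k. n \<ge> 1 \<Longrightarrow> measure M {\<omega> \<in> space M. Z n \<omega> = k} = q k"
begin

definition increment_law :: "int measure" where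
  "increment_law = density (count_space UNIV) (\<lambda>k. ennreal (q k))"

lemma measurable_increment [measurable]: "Z (Suc n) \<in> M \<rightarrow>\<^sub>M count_space UNIV"
  using indep unfolding indep_vars_def2 by simp

lemma measurable_increments [measurable]:
  "(\<lambda>\<omega> n. Z (Suc n) \<omega>) \<in> M \<rightarrow>\<^sub>M sequence_algebra"
  by (rule measurable_PiM_single') (simp_all add: space_PiM)

lemma distr_increment: "distr M (count_space UNIV) (Z (Suc n)) = increment_law"
proof (rule measure_eqI_countable[where A = UNIV])
  fix k :: int
  have "Z (Suc n) -` {k} \<inter> space M = {\<omega> \<in> space M. Z (Suc n) \<omega> = k}" by auto
  then have "emeasure (distr M (count_space UNIV) (Z (Suc n))) {k} = ennreal (q k)"
    by (simp add: emeasure_distr emeasure_eq_measure law)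
  then show "emeasure (distr M (count_space UNIV) (Z (Suc n))) {k} = emeasure increment_law {k}"
    unfolding increment_law_def
    by (subst emeasure_density, simp, simp, subst nn_integral_count_space'[where A = "{k}"]) auto
qed (simp_all add: increment_law_def)

lemma distr_increments:
  "distr M sequence_algebra (\<lambda>\<omega> n. Z (Suc n) \<omega>) = PiM UNIV (\<lambda>_. increment_law)"
proof -
  have "indep_vars (\<lambda>_. count_space UNIV) (\<lambda>n. Z (Suc n)) UNIV"
    by (rule indep_vars_reindex[where f = Suc and M' = "\<lambda>_. count_space UNIV" and X = Z])
       (auto intro!: indep_vars_subset[OF indep])
  then show ?thesis
    by (simp add: indep_vars_iff_distr_eq_PiM distr_increment restrict_UNIV)
qed

text \<open>
  The law of the sequence of increments is an infinite product measure with equal factors. This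
  product is invariant under prepending an independent copy of one factor, and Fubini's theorem
  separates that copy from the rest. After this the rest has the law of the full sequence, not
  of its tail, which is why the same variables reappear inside the inner integral.
\<close>

lemma nn_integral_split_first_increment:
  assumes F: "F \<in> borel_measurable sequence_algebra"
  shows "(\<integral>\<^sup>+\<omega>. F (\<lambda>n. Z (Suc n) \<omega>) \<partial>M) =
    (\<integral>\<^sup>+k. ennreal (q k) * (\<integral>\<^sup>+\<omega>. F (case_nat k (\<lambda>n. Z (Suc n) \<omega>)) \<partial>M) \<partial>count_space UNIV)"
proof -
  have sets_law [measurable_cong]: "sets increment_law = sets (count_space UNIV)"
    by (simp add: increment_law_def)
  interpret L: prob_space increment_law
    unfolding distr_increment[of 0, symmetric] by (rule prob_space_distr) simp
  interpret sequence_space increment_law ..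
  have sets_S: "sets S = sets sequence_algebra"
    by (intro sets_PiM_cong) (simp_all add: sets_law)
  have F' [measurable]: "F \<in> borel_measurable S"
    using F measurable_cong_sets[OF sets_S refl] by blast
  have law_S: "(\<integral>\<^sup>+w. G w \<partial>S) = (\<integral>\<^sup>+\<omega>. G (\<lambda>n. Z (Suc n) \<omega>) \<partial>M)"
    if G: "G \<in> borel_measurable S" for G :: "(nat \<Rightarrow> int) \<Rightarrow> ennreal"
  proof -
    have "G \<in> borel_measurable sequence_algebra"
      using G measurable_cong_sets[OF sets_S refl] by blast
    then show ?thesis
      unfolding distr_increments[symmetric] by (simp add: nn_integral_distr)
  qed
  have cons: "(\<lambda>w. F (case_nat k w)) \<in> borel_measurable S" for k
    by (rule measurable_compose[OF _ F']) (auto intro!: measurable_case_nat' simp: increment_law_def)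
  have "(\<integral>\<^sup>+\<omega>. F (\<lambda>n. Z (Suc n) \<omega>) \<partial>M) = (\<integral>\<^sup>+w. F w \<partial>S)"
    by (simp add: law_S)
  also have "\<dots> = (\<integral>\<^sup>+w. F w \<partial>distr (increment_law \<Otimes>\<^sub>M S) S (\<lambda>(k, w). case_nat k w))"
    by (simp add: PiM_iter)
  also have "\<dots> = (\<integral>\<^sup>+(k, w). F (case_nat k w) \<partial>(increment_law \<Otimes>\<^sub>M S))"
    by (subst nn_integral_distr) (simp_all add: case_prod_beta')
  also have "\<dots> = (\<integral>\<^sup>+k. \<integral>\<^sup>+w. F (case_nat k w) \<partial>S \<partial>increment_law)"
    by (subst nn_integral_fst[symmetric]) simp_all
  also have "\<dots> = (\<integral>\<^sup>+k. \<integral>\<^sup>+\<omega>. F (case_nat k (\<lambda>n. Z (Suc n) \<omega>)) \<partial>M \<partial>increment_law)"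
    by (simp add: law_S[OF cons])
  finally show ?thesis
    by (simp add: increment_law_def nn_integral_density)
qed

section \<open>The Bellman equation\<close>

text \<open>
  The rescaling of the reward that was explained at the beginning is an identity for every
  sequence of increments. It is integrated with the first increment separated from the others.
\<close>

lemma policy_value_first_step:
  assumes \<pi>: "\<pi> \<in> policies" and "x \<ge> 0" "y \<ge> 0" "\<beta> > 0" and a: "a = \<pi> 0 ([], x)"
  shows "policy_value M Z \<beta> \<gamma> \<pi> x y = ennreal (\<beta> powr \<gamma>) *
    (\<integral>\<^sup>+k. policy_value M Z \<beta> \<gamma> (continuation \<pi> x a) (x - a + k) ((of_int a + y) / \<beta>)
       * ennreal (q k) \<partial>count_space UNIV)"
proof -
  let ?R = "\<lambda>\<pi> x y z. ennreal_powr (discounted_dividends \<beta> \<pi> x z + ennreal y) \<gamma>"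
  let ?\<pi> = "continuation \<pi> x a" and ?y = "(of_int a + y) / \<beta>"
  have value_eq: "policy_value M Z \<beta> \<gamma> \<pi> x y = (\<integral>\<^sup>+\<omega>. ?R \<pi> x y (case_nat 0 (\<lambda>n. Z (Suc n) \<omega>)) \<partial>M)"
    for \<pi> x y
    unfolding policy_value_def
    by (intro nn_integral_cong arg_cong2[where f = ennreal_powr] arg_cong2[where f = "(+)"] refl
          discounted_dividends_cong_increments) simp
  have "a \<ge> 0"
    using action_at_nonneg[OF \<pi>, of x _ 0] by (simp add: action_at_def a)
  have step: "?R \<pi> x y (case_nat 0 (case_nat k w)) =
      ennreal (\<beta> powr \<gamma>) * ?R ?\<pi> (x - a + k) ?y (case_nat 0 w)" for k w
  proof -
    let ?D = "discounted_dividends \<beta> ?\<pi> (x - a + k) (case_nat 0 w)"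
    have "discounted_dividends \<beta> \<pi> x (case_nat 0 (case_nat k w)) = ennreal (of_int a) + ennreal \<beta> *
        discounted_dividends \<beta> ?\<pi> (x - a + k) (case_nat k w)"
      using discounted_dividends_first_step[OF \<pi> \<open>x \<ge> 0\<close> \<open>\<beta> > 0\<close> a, of "case_nat 0 (case_nat k w)"]
      by simp
    also have "discounted_dividends \<beta> ?\<pi> (x - a + k) (case_nat k w) = ?D"
      by (rule discounted_dividends_cong_increments) simp
    finally have "discounted_dividends \<beta> \<pi> x (case_nat 0 (case_nat k w)) + ennreal y =
        ennreal \<beta> * ?D + (ennreal (of_int a) + ennreal y)"
      by (simp add: ac_simps)
    also have "ennreal (of_int a) + ennreal y = ennreal \<beta> * ennreal ?y"
      using \<open>a \<ge> 0\<close> \<open>y \<ge> 0\<close> \<open>\<beta> > 0\<close> by (simp flip: ennreal_mult ennreal_plus)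
    finally have "discounted_dividends \<beta> \<pi> x (case_nat 0 (case_nat k w)) + ennreal y =
        ennreal \<beta> * (?D + ennreal ?y)"
      by (simp add: distrib_left)
    then show ?thesis by (simp add: ennreal_powr_mult[OF \<open>\<beta> > 0\<close>])
  qed
  have meas: "(\<lambda>w. ?R \<pi> x y (case_nat 0 w)) \<in> borel_measurable sequence_algebra" for \<pi> x y
    using measurable_discounted_dividends[measurable] by measurable
  have "policy_value M Z \<beta> \<gamma> \<pi> x y = (\<integral>\<^sup>+k. ennreal (q k) *
      (\<integral>\<^sup>+\<omega>. ?R \<pi> x y (case_nat 0 (case_nat k (\<lambda>n. Z (Suc n) \<omega>))) \<partial>M) \<partial>count_space UNIV)"
    unfolding value_eq
    by (rule nn_integral_split_first_increment[where F = "\<lambda>w. ?R \<pi> x y (case_nat 0 w)", OF meas])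
  also have "\<dots> = (\<integral>\<^sup>+k. ennreal (\<beta> powr \<gamma>) *
      (policy_value M Z \<beta> \<gamma> ?\<pi> (x - a + k) ?y * ennreal (q k)) \<partial>count_space UNIV)"
    unfolding step value_eq
    by (subst nn_integral_cmult) (use measurable_compose[OF measurable_increments meas] in \<open>simp_all add: ac_simps\<close>)
  finally show ?thesis by (simp add: nn_integral_cmult)
qed

lemma value_fun_bellman:
  assumes "x \<ge> 0" "y \<ge> 0" "\<beta> > 0"
  shows "value_fun M Z \<beta> \<gamma> x y = ennreal (\<beta> powr \<gamma>) *
    Max ((\<lambda>a. \<integral>\<^sup>+k. value_fun M Z \<beta> \<gamma> (x - a + k) ((of_int a + y) / \<beta>) * ennreal (q k)
               \<partial>count_space UNIV) ` actions x)"
    (is "_ = ?b * Max (?B ` _)")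
proof (rule antisym)
  have fin: "finite (?B ` actions x)" by (simp add: actions_def)
  show "value_fun M Z \<beta> \<gamma> x y \<le> ?b * Max (?B ` actions x)"
    unfolding value_fun_def[of M Z \<beta> \<gamma> x y]
  proof (rule SUP_least)
    fix \<pi> assume \<pi>: "\<pi> \<in> policies"
    define a where "a = \<pi> 0 ([], x)"
    have a: "a \<in> actions x"
      using policy_in_actions[OF \<pi>, of "([], x)" 0] by (simp add: histories_def a_def)
    have "policy_value M Z \<beta> \<gamma> \<pi> x y = ?b *
        (\<integral>\<^sup>+k. policy_value M Z \<beta> \<gamma> (continuation \<pi> x a) (x - a + k) ((of_int a + y) / \<beta>)
           * ennreal (q k) \<partial>count_space UNIV)"
      by (rule policy_value_first_step[OF \<pi> assms a_def])
    also have "\<dots> \<le> ?b * ?B a"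
      unfolding value_fun_def
      by (intro mult_left_mono nn_integral_mono mult_right_mono SUP_upper
            continuation_in_policies[OF \<pi> a]) simp_all
    also have "\<dots> \<le> ?b * Max (?B ` actions x)"
      using a by (intro mult_left_mono Max_ge fin) simp_all
    finally show "policy_value M Z \<beta> \<gamma> \<pi> x y \<le> ?b * Max (?B ` actions x)" .
  qed
  have "Max (?B ` actions x) \<in> ?B ` actions x"
    using zero_in_actions by (intro Max_in fin) auto
  then obtain a where a: "a \<in> actions x" and Max_eq: "Max (?B ` actions x) = ?B a"
    by auto
  let ?y = "(of_int a + y) / \<beta>"
  have "?b * ?B a = (\<integral>\<^sup>+k. (SUP \<pi>\<in>policies. ?b *
      (policy_value M Z \<beta> \<gamma> \<pi> (x - a + k) ?y * ennreal (q k))) \<partial>count_space UNIV)"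
    unfolding value_fun_def
    by (simp add: nn_integral_cmult[symmetric] SUP_mult_left_ennreal SUP_mult_right_ennreal)
  also have "\<dots> \<le> value_fun M Z \<beta> \<gamma> x y"
  proof (rule nn_integral_SUP_le_choice)
    show "policies \<noteq> {}"
      using zero_in_actions by (auto simp: policies_def intro!: exI[of _ "\<lambda>_ _. 0"])
  next
    fix \<sigma> :: "int \<Rightarrow> nat \<Rightarrow> history \<Rightarrow> int"
    assume \<sigma>: "\<And>k. \<sigma> k \<in> policies"
    \<comment> \<open>The increment \<open>k\<close> leads to the state \<open>x - a + k\<close>, so it is recovered from the state \<open>s\<close>
      as \<open>s - x + a\<close>.\<close>
    define \<pi> where "\<pi> = paste x a (\<lambda>s. \<sigma> (s - x + a))"
    have \<pi>: "\<pi> \<in> policies"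
      unfolding \<pi>_def by (intro paste_in_policies a \<sigma>)
    have "a = \<pi> 0 ([], x)" by (simp add: \<pi>_def paste_def)
    from policy_value_first_step[OF \<pi> assms this]
    have glued: "policy_value M Z \<beta> \<gamma> \<pi> x y = (\<integral>\<^sup>+k. ?b *
        (policy_value M Z \<beta> \<gamma> (\<sigma> k) (x - a + k) ?y * ennreal (q k)) \<partial>count_space UNIV)"
      by (simp add: \<pi>_def policy_value_continuation_paste nn_integral_cmult)
    show "(\<integral>\<^sup>+k. ?b * (policy_value M Z \<beta> \<gamma> (\<sigma> k) (x - a + k) ?y * ennreal (q k))
        \<partial>count_space UNIV) \<le> value_fun M Z \<beta> \<gamma> x y"
      unfolding glued[symmetric] value_fun_def by (rule SUP_upper[OF \<pi>])
  qed
  finally show "?b * Max (?B ` actions x) \<le> value_fun M Z \<beta> \<gamma> x y"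
    by (simp add: Max_eq)
qed

end

theorem theorem4p2:
  fixes M :: "'w measure" and Z :: "nat \<Rightarrow> 'w \<Rightarrow> int" and q :: "int \<Rightarrow> real"
    and \<beta> \<gamma> y :: real and x :: int
  assumes "prob_space M"
    and "prob_space.indep_vars M (\<lambda>_. count_space UNIV) Z {1..}"
    and "\<And>n k. n \<ge> 1 \<Longrightarrow> measure M {\<omega> \<in> space M. Z n \<omega> = k} = q k"
    and "integrable M (\<lambda>\<omega>. real_of_int (max (Z 1 \<omega>) 0))"
    and "measure M {\<omega> \<in> space M. Z 1 \<omega> < 0} > 0"
    and "0 < \<beta>" "\<beta> < 1"
    and "0 < \<gamma>" "\<gamma> < 1"
    and "x \<ge> 0" "y \<ge> 0"
  shows "value_fun M Z \<beta> \<gamma> x y =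
      ennreal (\<beta> powr \<gamma>) *
        Max ((\<lambda>a. \<Sum>\<^sub>\<infinity>x'\<in>UNIV. value_fun M Z \<beta> \<gamma> x' ((of_int a + y) / \<beta>)
                             * ennreal (transition q x' x a)) ` actions x)
    \<and> value_fun M Z \<beta> \<gamma> x y =
      ennreal (\<beta> powr \<gamma>) *
        Max ((\<lambda>a. \<Sum>\<^sub>\<infinity>k\<in>UNIV. value_fun M Z \<beta> \<gamma> (x - a + k) ((of_int a + y) / \<beta>)
                             * ennreal (q k)) ` actions x)"
proof -
  interpret iid_increments M Z q
    using assms(1-3) by (simp add: iid_increments_def iid_increments_axioms_def)
  let ?J = "value_fun M Z \<beta> \<gamma>"
  have bellman: "?J x y = ennreal (\<beta> powr \<gamma>) * Max ((\<lambda>a. \<Sum>\<^sub>\<infinity>k\<in>UNIV.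
      ?J (x - a + k) ((of_int a + y) / \<beta>) * ennreal (q k)) ` actions x)"
    unfolding infsum_eq_nn_integral_count_space using assms by (intro value_fun_bellman)
  have "(\<Sum>\<^sub>\<infinity>x'\<in>UNIV. ?J x' ((of_int a + y) / \<beta>) * ennreal (transition q x' x a)) =
      (\<Sum>\<^sub>\<infinity>k\<in>UNIV. ?J (x - a + k) ((of_int a + y) / \<beta>) * ennreal (q k))" for a
    by (rule infsum_reindex_bij_witness[where i = "\<lambda>k. x - a + k" and j = "\<lambda>x'. x' - x + a"])
       (use \<open>x \<ge> 0\<close> in \<open>simp_all add: transition_def\<close>)
  with bellman show ?thesis by simp
qed

end
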